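(* Let $\lambda>0$ be a rational number and $q\ge2$ an integer, and let $X_q=\{q^n:n\in\mathbb{Z}\}\subset\mathbb{R}$ with the metric induced from $\mathbb{R}$. Then the similarity transformation $H_\lambda$ keeps $X_q$ in the same cloud (i.e., $\lambda X_q$ lies in the cloud containing $X_q$) if and only if $\lambda=q^\alpha$ for some $\alpha\in\mathbb{Z}$.
   Context: The Gromov--Hausdorff distance $d_{GH}(X,Y)\in[0,\infty]$ between non-empty metric spaces is the infimum of the Hausdorff distances $d_H(X',Y')$ over all metric spaces $Z$ and all subsets $X',Y'\subset Z$ isometric to $X$ and $Y$ respectively; it is a generalized pseudometric on the class of all non-empty metric spaces considered up to isometry (the value $\infty$ is allowed). A cloud is an equivalence class of the relation $d_{GH}(X,Y)<\infty$ on this class. For a metric space $X$ and real $\lambda>0$, $\lambda X$ is the metric space obtained from $X$ by multiplying all distances by $\lambda$, and $H_\lambda\colon X\mapsto\lambda X$ is the similarity transformation with coefficient $\lambda$. *)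

theory Defs
  imports "HOL-Analysis.Analysis"
begin

text \<open>Metric spaces are elements of the library type \<open>'a metric\<close>; the carrier \<open>mspace X\<close> is an
  arbitrary, possibly empty, subset of the type.\<close>

definition isometric :: "'a metric \<Rightarrow> 'b metric \<Rightarrow> bool" where
  "isometric X Y \<longleftrightarrow>
     (\<exists>f. bij_betw f (mspace X) (mspace Y) \<and>
          (\<forall>x\<in>mspace X. \<forall>y\<in>mspace X. mdist Y (f x) (f y) = mdist X x y))"

definition hausdorff_dist :: "'a metric \<Rightarrow> 'a set \<Rightarrow> 'a set \<Rightarrow> ennreal" where
  "hausdorff_dist Z A B =
     max (SUP a\<in>A. INF b\<in>B. ennreal (mdist Z a b)) (SUP b\<in>B. INF a\<in>A. ennreal (mdist Z a b))"

text \<open>HOL cannot quantify over all types, so the ambient space \<open>Z\<close> ranges over the metric spaces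
  with points in the disjoint sum \<open>'a + 'b\<close>. This does not change the infimum: \<open>Z\<close> may be replaced
  by the union of the two copies, which fits into \<open>'a + 'b\<close>. The lemma \<open>gh_dist_le\<close> below confirms
  that ambient spaces over any other type give no smaller value.\<close>

definition gh_dist :: "'a metric \<Rightarrow> 'b metric \<Rightarrow> ennreal" where
  "gh_dist X Y =
     Inf {hausdorff_dist Z A B | (Z :: ('a + 'b) metric) A B.
            A \<subseteq> mspace Z \<and> B \<subseteq> mspace Z \<and>
            isometric (submetric Z A) X \<and> isometric (submetric Z B) Y}"

text \<open>The cloud of \<open>X\<close>, cut down to the spaces whose points have the same type as those of \<open>X\<close>
  (again because HOL has no type of all metric spaces).\<close>

definition cloud_rel :: "('a metric \<times> 'a metric) set" where
  "cloud_rel = {(X, Y). mspace X \<noteq> {} \<and> mspace Y \<noteq> {} \<and> gh_dist X Y < \<infinity>}"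

definition cloud :: "'a metric \<Rightarrow> 'a metric set" where
  "cloud X = cloud_rel `` {X}"

text \<open>The similarity transformation \<open>H\<close> with coefficient \<open>l\<close>; it is meaningful only for \<open>l > 0\<close>,
  where the pair below satisfies the metric axioms.\<close>

definition similarity :: "real \<Rightarrow> 'a metric \<Rightarrow> 'a metric" where
  "similarity l X = metric (mspace X, \<lambda>x y. l * mdist X x y)"

definition geom_space :: "int \<Rightarrow> real metric" where
  "geom_space q = submetric euclidean_metric {real_of_int q powi n | n :: int. True}"


lemma Metric_space_similarity:
  assumes "l > 0"
  shows "Metric_space (mspace X) (\<lambda>x y. l * mdist X x y)"
proof
  fix x y z assume "x \<in> mspace X" "y \<in> mspace X" "z \<in> mspace X"
  then have "mdist X x z \<le> mdist X x y + mdist X y z" by (rule mdist_triangle)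
  then have "l * mdist X x z \<le> l * (mdist X x y + mdist X y z)"
    using assms by simp
  then show "l * mdist X x z \<le> l * mdist X x y + l * mdist X y z"
    by (simp add: distrib_left)
qed (use assms in \<open>auto simp: mdist_commute\<close>)

lemma mspace_similarity: "l > 0 \<Longrightarrow> mspace (similarity l X) = mspace X"
  unfolding similarity_def by (rule Metric_space.mspace_metric[OF Metric_space_similarity])

lemma mdist_similarity: "l > 0 \<Longrightarrow> mdist (similarity l X) = (\<lambda>x y. l * mdist X x y)"
  unfolding similarity_def by (rule Metric_space.mdist_metric[OF Metric_space_similarity])

lemma gh_dist_le:
  fixes X :: "'a metric" and Y :: "'b metric" and Z :: "'c metric"
  assumes "A \<subseteq> mspace Z" "B \<subseteq> mspace Z"
    and "isometric (submetric Z A) X" "isometric (submetric Z B) Y"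
  shows "gh_dist X Y \<le> hausdorff_dist Z A B"
proof -
  have eq: "A \<inter> mspace Z = A" "B \<inter> mspace Z = B" using assms by auto
  obtain f where f: "bij_betw f A (mspace X)"
    and fd: "\<And>x y. x \<in> A \<Longrightarrow> y \<in> A \<Longrightarrow> mdist X (f x) (f y) = mdist Z x y"
    using assms(3) unfolding isometric_def by (auto simp: eq)
  obtain g where g: "bij_betw g B (mspace Y)"
    and gd: "\<And>x y. x \<in> B \<Longrightarrow> y \<in> B \<Longrightarrow> mdist Y (g x) (g y) = mdist Z x y"
    using assms(4) unfolding isometric_def by (auto simp: eq)
  define e :: "'c \<Rightarrow> 'a + 'b" where "e z = (if z \<in> A then Inl (f z) else Inr (g z))" for z
  define h where "h = the_inv_into (A \<union> B) e"
  have inj: "inj_on e (A \<union> B)"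
    using f g unfolding inj_on_def e_def bij_betw_def by auto
  have he: "h (e z) = z" if "z \<in> A \<union> B" for z
    unfolding h_def by (rule the_inv_into_f_f[OF inj that])
  define W where "W = metric (e ` (A \<union> B), \<lambda>u v. mdist Z (h u) (h v))"
  have MW: "Metric_space (e ` (A \<union> B)) (\<lambda>u v. mdist Z (h u) (h v))"
  proof
    fix x y assume "x \<in> e ` (A \<union> B)" "y \<in> e ` (A \<union> B)"
    then obtain a b where ab: "a \<in> A \<union> B" "b \<in> A \<union> B" "x = e a" "y = e b" by blast
    have "a \<in> mspace Z" "b \<in> mspace Z" using ab assms by auto
    then have "mdist Z a b = 0 \<longleftrightarrow> a = b" by simp
    then show "(mdist Z (h x) (h y) = 0) = (x = y)"
      using ab he inj by (metis inj_onD)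
  next
    fix x y z assume "x \<in> e ` (A \<union> B)" "y \<in> e ` (A \<union> B)" "z \<in> e ` (A \<union> B)"
    then have "h x \<in> mspace Z" "h y \<in> mspace Z" "h z \<in> mspace Z" using he assms by auto
    then show "mdist Z (h x) (h z) \<le> mdist Z (h x) (h y) + mdist Z (h y) (h z)"
      by (rule mdist_triangle)
  qed (auto simp: mdist_commute)
  have mW: "mspace W = e ` (A \<union> B)"
    unfolding W_def by (rule Metric_space.mspace_metric[OF MW])
  have dW: "mdist W = (\<lambda>u v. mdist Z (h u) (h v))"
    unfolding W_def by (rule Metric_space.mdist_metric[OF MW])
  have sub: "e ` A \<subseteq> mspace W" "e ` B \<subseteq> mspace W" unfolding mW by auto
  have bh: "bij_betw h (e ` C) C" if "C \<subseteq> A \<union> B" for C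
    unfolding bij_betw_def
    by (smt (verit) that he image_iff inj_on_def subset_eq subset_antisym)
  have iA: "isometric (submetric W (e ` A)) X"
    unfolding isometric_def
  proof (intro exI conjI ballI)
    show "bij_betw (f \<circ> h) (mspace (submetric W (e ` A))) (mspace X)"
      using bij_betw_trans[OF bh f] sub by (simp add: Int_absorb2)
    fix x y assume "x \<in> mspace (submetric W (e ` A))" "y \<in> mspace (submetric W (e ` A))"
    then show "mdist X ((f \<circ> h) x) ((f \<circ> h) y) = mdist (submetric W (e ` A)) x y"
      using he by (auto simp: dW fd)
  qed
  have iB: "isometric (submetric W (e ` B)) Y"
    unfolding isometric_def
  proof (intro exI conjI ballI)
    show "bij_betw (g \<circ> h) (mspace (submetric W (e ` B))) (mspace Y)"
      using bij_betw_trans[OF bh g] sub by (simp add: Int_absorb2)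
    fix x y assume "x \<in> mspace (submetric W (e ` B))" "y \<in> mspace (submetric W (e ` B))"
    then show "mdist Y ((g \<circ> h) x) ((g \<circ> h) y) = mdist (submetric W (e ` B)) x y"
      using he by (auto simp: dW gd)
  qed
  have "hausdorff_dist W (e ` A) (e ` B) = hausdorff_dist Z A B"
    unfolding hausdorff_dist_def image_image dW by (simp add: he cong: SUP_cong INF_cong)
  then have "hausdorff_dist Z A B \<in> {hausdorff_dist Z A B | (Z :: ('a + 'b) metric) A B.
            A \<subseteq> mspace Z \<and> B \<subseteq> mspace Z \<and>
            isometric (submetric Z A) X \<and> isometric (submetric Z B) Y}"
    using sub iA iB by (smt (verit) mem_Collect_eq)
  then show ?thesis unfolding gh_dist_def by (rule Inf_lower)
qed

end

theory Submission
  imports Defs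
begin

text \<open>A finite Gromov--Hausdorff distance gives a map \<open>X\<^sub>q \<rightarrow> \<lambda>X\<^sub>q\<close> with bounded distortion. Comparing
  distances to a fixed base point, \<open>q\<^sup>m\<close> lies within a bounded distance of some \<open>\<lambda>q\<^sup>j\<close> for every
  \<open>m \<ge> 0\<close>; dividing by \<open>q\<^sup>m\<close>, the number \<open>1\<close> is a limit of numbers \<open>\<lambda>q\<^sup>i\<close>. These are discrete in
  \<open>(0, \<infinity>)\<close>, so \<open>1\<close> is one of them.\<close>

text \<open>The space \<open>X\<close> itself serves as ambient space: both copies are all of
  \<open>X\<close>, and every point is its own nearest point.\<close>

lemma gh_dist_isometric:
  assumes "isometric X Y"
  shows "gh_dist X Y = 0"
proof -
  have "isometric (submetric X (mspace X)) X"
    unfolding isometric_def by (rule exI[of _ id]) simp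
  moreover have "isometric (submetric X (mspace X)) Y"
    using assms unfolding isometric_def by simp
  ultimately have "gh_dist X Y \<le> hausdorff_dist X (mspace X) (mspace X)"
    by (intro gh_dist_le) auto
  also have "\<dots> = 0"
  proof -
    have "(INF b\<in>mspace X. ennreal (mdist X a b)) = 0"
         "(INF b\<in>mspace X. ennreal (mdist X b a)) = 0" if "a \<in> mspace X" for a
      using that by (auto intro!: antisym INF_lower2[OF that])
    then have "hausdorff_dist X (mspace X) (mspace X) \<le> 0"
      unfolding hausdorff_dist_def by (intro max.boundedI SUP_least) auto
    then show ?thesis by simp
  qed
  finally show ?thesis by simp
qed

text \<open>In an ambient space where the two copies are at finite Hausdorff distance, each point of
  the first copy is moved to a point of the second at distance less than some \<open>c\<close>. By
  the triangle inequality this changes distances by at most \<open>2 * c\<close>.\<close>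

lemma gh_dist_finite_imp_bounded_distortion:
  assumes "gh_dist X Y < \<infinity>"
  obtains f C where "f \<in> mspace X \<rightarrow> mspace Y"
    and "\<And>x x'. x \<in> mspace X \<Longrightarrow> x' \<in> mspace X \<Longrightarrow>
           \<bar>mdist Y (f x) (f x') - mdist X x x'\<bar> \<le> C"
proof -
  obtain Z :: "('a + 'b) metric" and A B where AZ: "A \<subseteq> mspace Z" and BZ: "B \<subseteq> mspace Z"
    and iA: "isometric (submetric Z A) X" and iB: "isometric (submetric Z B) Y"
    and fin: "hausdorff_dist Z A B < \<infinity>"
    using assms unfolding gh_dist_def Inf_less_iff by (elim bexE CollectE exE conjE) simp
  have eq: "A \<inter> mspace Z = A" "B \<inter> mspace Z = B" using AZ BZ by auto
  obtain g where g: "bij_betw g A (mspace X)"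
    and gd: "\<And>x y. x \<in> A \<Longrightarrow> y \<in> A \<Longrightarrow> mdist X (g x) (g y) = mdist Z x y"
    using iA unfolding isometric_def by (auto simp: eq)
  obtain h where h: "bij_betw h B (mspace Y)"
    and hd: "\<And>x y. x \<in> B \<Longrightarrow> y \<in> B \<Longrightarrow> mdist Y (h x) (h y) = mdist Z x y"
    using iB unfolding isometric_def by (auto simp: eq)
  \<comment> \<open>A bound strictly above the Hausdorff distance: the infimum over \<open>B\<close>
    need not be attained, but some point of \<open>B\<close> does lies closer than
    \<open>c\<close>.\<close>
  obtain c where c: "hausdorff_dist Z A B < ennreal c"
    using fin by (metis infinity_ennreal_def ennreal_Ex_less_of_nat ennreal_of_nat_eq_real_of_nat)
  have "\<exists>b\<in>B. mdist Z a b < c" if "a \<in> A" for a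
  proof -
    have "(INF b\<in>B. ennreal (mdist Z a b)) \<le> hausdorff_dist Z A B"
      unfolding hausdorff_dist_def using that by (intro max.coboundedI1 SUP_upper)
    then have "(INF b\<in>B. ennreal (mdist Z a b)) < ennreal c" using c by simp
    then show ?thesis
      unfolding INF_less_iff by (auto simp: ennreal_less_iff)
  qed
  then obtain p where pB: "\<And>a. a \<in> A \<Longrightarrow> p a \<in> B" and pd: "\<And>a. a \<in> A \<Longrightarrow> mdist Z a (p a) < c"
    by metis
  \<comment> \<open>\<open>s\<close> lifts points of \<open>X\<close> to the copy \<open>A\<close>;
    the desired map goes through \<open>A\<close> and \<open>B\<close> as \<open>h\<close>,
    \<open>p\<close>, \<open>s\<close> composed.\<close>
  define s where "s = inv_into A g"
  have s: "s x \<in> A" "g (s x) = x" if "x \<in> mspace X" for x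
    using that g unfolding s_def bij_betw_def by (auto intro: inv_into_into f_inv_into_f)
  show ?thesis
  proof
    show "(\<lambda>x. h (p (s x))) \<in> mspace X \<rightarrow> mspace Y"
      using s pB h by (auto simp: bij_betw_def)
    fix x x' assume x: "x \<in> mspace X" "x' \<in> mspace X"
    let ?a = "s x" and ?a' = "s x'"
    have A: "?a \<in> A" "?a' \<in> A" using x s by auto
    have Z: "?a \<in> mspace Z" "?a' \<in> mspace Z" "p ?a \<in> mspace Z" "p ?a' \<in> mspace Z"
      using A pB AZ BZ by auto
    have "mdist Z ?a ?a' \<le> mdist Z ?a (p ?a) + (mdist Z (p ?a) (p ?a') + mdist Z (p ?a') ?a')"
      using mdist_triangle[OF Z(1,3,2)] mdist_triangle[OF Z(3,4,2)] by simp
    moreover have "mdist Z (p ?a) (p ?a') \<le> mdist Z (p ?a) ?a + (mdist Z ?a ?a' + mdist Z ?a' (p ?a'))"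
      using mdist_triangle[OF Z(3,1,4)] mdist_triangle[OF Z(1,2,4)] by simp
    moreover have "mdist Y (h (p ?a)) (h (p ?a')) = mdist Z (p ?a) (p ?a')"
      using A pB hd by simp
    moreover have "mdist X x x' = mdist Z ?a ?a'"
      using gd[OF A] s x by simp
    ultimately show "\<bar>mdist Y (h (p ?a)) (h (p ?a')) - mdist X x x'\<bar> \<le> 2 * c"
      using pd[OF A(1)] pd[OF A(2)] mdist_commute[of Z] by (smt (verit))
  qed
qed

lemma mspace_geom_space: "mspace (geom_space q) = range (\<lambda>n. real_of_int q powi n)"
  unfolding geom_space_def by auto

lemma mdist_geom_space: "mdist (geom_space q) x y = \<bar>x - y\<bar>"
  unfolding geom_space_def by (simp add: dist_real_def)

text \<open>Division by \<open>?r powi \<alpha>\<close> merely shifts exponents, so it permutes the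
  points, and the factor by which it shrinks distances is undone by the similarity.\<close>

lemma isometric_geom_space_similarity:
  assumes "q > 0"
  shows "isometric (geom_space q) (similarity (real_of_int q powi \<alpha>) (geom_space q))"
proof -
  let ?r = "real_of_int q"
  have r: "?r > 0" using assms by simp
  then have l: "?r powi \<alpha> > 0" by (rule zero_less_power_int)
  have "bij_betw (\<lambda>x. x / ?r powi \<alpha>) (range (\<lambda>n. ?r powi n)) (range (\<lambda>n. ?r powi n))"
  proof (rule bij_betw_byWitness[where f' = "\<lambda>x. ?r powi \<alpha> * x"])
    show "(\<lambda>x. x / ?r powi \<alpha>) ` range (\<lambda>n. ?r powi n) \<subseteq> range (\<lambda>n. ?r powi n)"
      using r by (auto simp flip: power_int_diff)
    show "(\<lambda>x. ?r powi \<alpha> * x) ` range (\<lambda>n. ?r powi n) \<subseteq> range (\<lambda>n. ?r powi n)"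
      using r by (auto simp flip: power_int_add)
  qed (use l r in auto)
  moreover have "?r powi \<alpha> * \<bar>x / ?r powi \<alpha> - y / ?r powi \<alpha>\<bar> = \<bar>x - y\<bar>" for x y
    using l r by (simp add: abs_mult flip: diff_divide_distrib)
  ultimately show ?thesis
    unfolding isometric_def mspace_similarity[OF l] mdist_similarity[OF l]
      mspace_geom_space mdist_geom_space by blast
qed

text \<open>If 1 were not a term, it would lie strictly between two consecutive terms, and by
  monotonicity no term comes closer to 1 than the nearer of these two.\<close>

lemma one_limit_of_geometric:
  fixes l r :: real
  assumes l: "l > 0" and r: "r > 1"
    and approx: "\<And>e. e > 0 \<Longrightarrow> \<exists>j. \<bar>l * r powi j - 1\<bar> < e"
  shows "\<exists>j. l * r powi j = 1"
proof (rule ccontr)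
  assume no: "\<nexists>j. l * r powi j = 1"
  \<comment> \<open>The largest integer \<open>k\<close> with
    \<open>l * r powi k \<le> 1\<close>.\<close>
  define k where "k = \<lfloor>log r (1 / l)\<rfloor>"
  have "r powr real_of_int k \<le> 1 / l" "1 / l < r powr real_of_int (k + 1)"
    using l r by (simp_all add: k_def powr_le_iff less_powr_iff)
  then have "r powi k \<le> 1 / l" "1 / l < r powi (k + 1)"
    using r powr_real_of_int'[of r k] powr_real_of_int'[of r "k + 1"] by simp_all
  \<comment> \<open>The floor leaves equality possible at \<open>k\<close>, and \<open>no\<close>
    excludes it. Both gaps are thus positive, and the smaller one is a valid
    \<open>e\<close>.\<close>
  then have "l * r powi k < 1" and "1 < l * r powi (k + 1)"
    using l no by (auto simp: field_simps order_less_le)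
  then obtain j where j: "\<bar>l * r powi j - 1\<bar> < min (1 - l * r powi k) (l * r powi (k + 1) - 1)"
    using approx[of "min (1 - l * r powi k) (l * r powi (k + 1) - 1)"] by auto
  show False
  proof (cases "j \<le> k")
    case True
    then have "l * r powi j \<le> l * r powi k"
      using l r by (simp add: power_int_increasing)
    then show False using j by linarith
  next
    case False
    then have "l * r powi (k + 1) \<le> l * r powi j"
      using l r by (intro mult_left_mono power_int_increasing) auto
    then show False using j by linarith
  qed
qed

lemma gh_dist_geom_space_similarity_finite:
  assumes l: "l > 0" and q: "q \<ge> 2"
    and fin: "gh_dist (geom_space q) (similarity l (geom_space q)) < \<infinity>"
  shows "\<exists>\<alpha>. l = real_of_int q powi \<alpha>"
proof -
  let ?r = "real_of_int q"
  have r: "?r > 1" using q by simp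
  obtain f C where f: "f \<in> range (\<lambda>n. ?r powi n) \<rightarrow> range (\<lambda>n. ?r powi n)"
    and fC: "\<And>x x'. x \<in> range (\<lambda>n. ?r powi n) \<Longrightarrow> x' \<in> range (\<lambda>n. ?r powi n) \<Longrightarrow>
           \<bar>l * \<bar>f x - f x'\<bar> - \<bar>x - x'\<bar>\<bar> \<le> C"
    using gh_dist_finite_imp_bounded_distortion[OF fin]
    unfolding mspace_similarity[OF l] mdist_similarity[OF l] mspace_geom_space mdist_geom_space
    by metis
  have one: "1 \<in> range (\<lambda>n. ?r powi n)" by (rule image_eqI[of _ _ 0]) auto
  have pos: "f x > 0" if "x \<in> range (\<lambda>n. ?r powi n)" for x
    using funcset_mem[OF f that] r by auto
  \<comment> \<open>By positivity, replacing \<open>l * \<bar>f x - f 1\<bar>\<close> by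
    \<open>l * f x\<close> costs at most \<open>l * f 1\<close>, and replacing \<open>x - 1\<close>
    by \<open>x\<close> costs 1. The factor 3 leaves slack.\<close>
  define D where "D = C + 3 * (l * f 1) + 1"
  have D: "\<exists>j. \<bar>l * ?r powi j - ?r ^ m\<bar> \<le> D" for m :: nat
  proof -
    have m: "?r ^ m \<in> range (\<lambda>n. ?r powi n)" by (rule image_eqI[of _ _ "int m"]) auto
    obtain j where j: "f (?r ^ m) = ?r powi j" using funcset_mem[OF f m] by auto
    have "?r ^ m \<ge> 1" using r by simp
    moreover have "\<bar>l * \<bar>f (?r ^ m) - f 1\<bar> - \<bar>?r ^ m - 1\<bar>\<bar> \<le> C" by (rule fC[OF m one])
    moreover have "l * \<bar>f (?r ^ m) - f 1\<bar> = \<bar>l * f (?r ^ m) - l * f 1\<bar>"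
      using l by (simp add: abs_mult flip: right_diff_distrib)
    moreover have "l * f 1 > 0" "l * f (?r ^ m) > 0" using l pos[OF one] pos[OF m] by auto
    ultimately have "\<bar>l * f (?r ^ m) - ?r ^ m\<bar> \<le> D" unfolding D_def by linarith
    then show ?thesis using j by auto
  qed
  have "\<exists>j. \<bar>l * ?r powi j - 1\<bar> < e" if "e > 0" for e
  proof -
    \<comment> \<open>\<open>D\<close> is independent of \<open>m\<close>, so a large
      \<open>m\<close> makes the error relative to \<open>?r ^ m\<close> smaller than
      \<open>e\<close>.\<close>
    obtain m where m: "D / e < ?r ^ m" using real_arch_pow[OF r] by blast
    obtain j where j: "\<bar>l * ?r powi j - ?r ^ m\<bar> \<le> D" using D by blast
    have rm: "?r ^ m > 0" using r by simp
    have "l * ?r powi (j - int m) - 1 = (l * ?r powi j - ?r ^ m) / ?r ^ m"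
      using r by (simp add: power_int_diff diff_divide_distrib)
    then have "\<bar>l * ?r powi (j - int m) - 1\<bar> \<le> D / ?r ^ m"
      using j rm by (simp add: abs_divide divide_right_mono)
    also have "\<dots> < e" using m that rm by (simp add: field_simps)
    finally show ?thesis by blast
  qed
  then obtain j where "l * ?r powi j = 1" using one_limit_of_geometric[OF l r] by blast
  then have "l = ?r powi (- j)" using r by (simp add: power_int_minus field_simps)
  then show ?thesis by blast
qed

theorem theorem5p2:
  fixes l :: real and q :: int
  assumes "l > 0" and "l \<in> \<rat>" and "q \<ge> 2"
  shows "similarity l (geom_space q) \<in> cloud (geom_space q) \<longleftrightarrow>
           (\<exists>\<alpha>::int. l = real_of_int q powi \<alpha>)"
proof -
  have "similarity l (geom_space q) \<in> cloud (geom_space q) \<longleftrightarrow>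
          gh_dist (geom_space q) (similarity l (geom_space q)) < \<infinity>"
    unfolding cloud_def cloud_rel_def using assms(1)
    by (simp add: mspace_similarity mspace_geom_space)
  \<comment> \<open>Here the two spaces are even isometric, so the distance is 0.\<close>
  moreover have "gh_dist (geom_space q) (similarity l (geom_space q)) < \<infinity>"
    if "l = real_of_int q powi \<alpha>" for \<alpha>
    using gh_dist_isometric[OF isometric_geom_space_similarity[of q \<alpha>]] assms(3) that by simp
  ultimately show ?thesis
    using gh_dist_geom_space_similarity_finite[OF assms(1,3)] by blast
qed

end
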